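(* Let $f$ be a parity edge-coloring of $K_n$ in which every color class is a perfect matching of $K_n$. Then $f$ is a canonical coloring and $n$ is a power of $2$. That is, $n=2^k$ for some integer $k\ge 0$, and there are a bijection $\phi: V(K_n)\to\mathbb{F}_2^k$ and a naming of the colors used by $f$ by distinct elements of $\mathbb{F}_2^k$ such that the color of each edge $uv$ is named $\phi(u)+\phi(v)$.
   Context: $K_n$ is the complete graph on $n$ vertices. An edge-coloring of a graph is any assignment of colors to its edges; the color class of a color that is used is the set of edges receiving that color. A parity walk (in an edge-coloring) is a walk along which every color is used an even number of times. A parity path is a parity walk that is a path with at least one edge (no repeated vertices, so distinct endpoints). A parity edge-coloring is an edge-coloring having no parity path. When $n=2^k$, the canonical coloring of $K_n$ is the edge-coloring $f$ defined by $f(uv)=u+v$, where $V(K_n)=\mathbb{F}_2^k$ and addition is binary vector addition; an edge-coloring is called canonical if it is of this form up to naming of vertices and colors. *)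

theory Defs
  imports "HOL-Library.Ramsey" "HOL-Library.Z2" "Jordan_Normal_Form.Matrix"
begin

text \<open>Graphs are simple and undirected, given by a vertex set \<open>V\<close> and a set \<open>E\<close> of two-element
  subsets of \<open>V\<close>; an edge-coloring is a function on edges, of which only the values on \<open>E\<close> matter.\<close>

definition complete_graph_edges :: "'v set \<Rightarrow> 'v set set" where
  "complete_graph_edges V = nsets V 2"

definition color_class :: "'v set set \<Rightarrow> ('v set \<Rightarrow> 'c) \<Rightarrow> 'c \<Rightarrow> 'v set set" where
  "color_class E f c = {e \<in> E. f e = c}"

definition perfect_matching :: "'v set \<Rightarrow> 'v set set \<Rightarrow> 'v set set \<Rightarrow> bool" where
  "perfect_matching V E M \<longleftrightarrow> M \<subseteq> E \<and> (\<forall>v\<in>V. \<exists>!e. e \<in> M \<and> v \<in> e)"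

text \<open>A walk is the nonempty list of its successive vertices.\<close>

fun walk_edges :: "'v list \<Rightarrow> 'v set list" where
  "walk_edges (u # v # xs) = {u, v} # walk_edges (v # xs)"
| "walk_edges _ = []"

definition walk :: "'v set \<Rightarrow> 'v set set \<Rightarrow> 'v list \<Rightarrow> bool" where
  "walk V E xs \<longleftrightarrow> xs \<noteq> [] \<and> set xs \<subseteq> V \<and> set (walk_edges xs) \<subseteq> E"

definition parity_walk :: "'v set \<Rightarrow> 'v set set \<Rightarrow> ('v set \<Rightarrow> 'c) \<Rightarrow> 'v list \<Rightarrow> bool" where
  "parity_walk V E f xs \<longleftrightarrow>
     walk V E xs \<and> (\<forall>c. even (count_list (map f (walk_edges xs)) c))"

definition parity_path :: "'v set \<Rightarrow> 'v set set \<Rightarrow> ('v set \<Rightarrow> 'c) \<Rightarrow> 'v list \<Rightarrow> bool" where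
  "parity_path V E f xs \<longleftrightarrow> parity_walk V E f xs \<and> distinct xs \<and> walk_edges xs \<noteq> []"

definition parity_edge_coloring :: "'v set \<Rightarrow> 'v set set \<Rightarrow> ('v set \<Rightarrow> 'c) \<Rightarrow> bool" where
  "parity_edge_coloring V E f \<longleftrightarrow> (\<nexists>xs. parity_path V E f xs)"

text \<open>\<open>\<phi>\<close> names the vertices and \<open>\<psi>\<close> names the colors actually used. The space
  of binary vectors of length \<open>k\<close> is \<^term>\<open>carrier_vec k :: bit vec set\<close>, where addition is componentwise modulo 2.\<close>

definition canonical_coloring :: "nat \<Rightarrow> 'v set \<Rightarrow> ('v set \<Rightarrow> 'c) \<Rightarrow> bool" where
  "canonical_coloring k V f \<longleftrightarrow>
     (\<exists>(\<phi> :: 'v \<Rightarrow> bit vec) (\<psi> :: 'c \<Rightarrow> bit vec).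
        bij_betw \<phi> V (carrier_vec k) \<and>
        inj_on \<psi> (f ` complete_graph_edges V) \<and>
        \<psi> ` (f ` complete_graph_edges V) \<subseteq> carrier_vec k \<and>
        (\<forall>u\<in>V. \<forall>v\<in>V. u \<noteq> v \<longrightarrow> \<psi> (f {u, v}) = \<phi> u + \<phi> v))"

end

theory Submission
  imports Defs
begin

text \<open>Write \<open>\<sigma>\<^sub>c\<close> for the fixed-point-free involution of \<open>V\<close> given by the perfect matching of color
  \<open>c\<close>. Following the colors \<open>a, c, a, c\<close> gives a parity walk with four edges that is a path unless
  it closes up, so all these involutions commute. With the identity they form a group of exponent
  two acting on \<open>V\<close>; the action is transitive because \<open>K\<^sub>n\<close> is complete, hence regular because the
  group is abelian. Transporting this group to \<open>V\<close> along a base point makes \<open>V\<close> an elementary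
  abelian \<open>2\<close>-group in which the color of \<open>uv\<close> depends only on, and determines, the product of
  \<open>u\<close> and \<open>v\<close>.\<close>

section \<open>Finite groups of exponent two\<close>

lemma carrier_vec_Suc_bit:
  "(carrier_vec (Suc k) :: bit vec set) = vCons 0 ` carrier_vec k \<union> vCons 1 ` carrier_vec k"
proof (intro equalityI subsetI)
  fix v :: "bit vec"
  assume v: "v \<in> carrier_vec (Suc k)"
  show "v \<in> vCons 0 ` carrier_vec k \<union> vCons 1 ` carrier_vec k"
  proof (cases v)
    case vNil
    with v show ?thesis by auto
  next
    case (vCons a w)
    with v show ?thesis by (cases a) auto
  qed
qed auto

lemma card_carrier_vec_bit:
  "finite (carrier_vec k :: bit vec set) \<and> card (carrier_vec k :: bit vec set) = 2 ^ k"
proof (induction k)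
  case 0
  have "(carrier_vec 0 :: bit vec set) = {vNil}"
    by auto
  then show ?case by simp
next
  case (Suc k)
  have "card (vCons (0::bit) ` carrier_vec k \<union> vCons 1 ` carrier_vec k)
      = card (vCons (0::bit) ` carrier_vec k) + card (vCons (1::bit) ` carrier_vec k)"
    using Suc by (intro card_Un_disjoint) auto
  also have "\<dots> = 2 ^ Suc k"
    using Suc by (simp add: card_image inj_on_def)
  finally show ?case
    using Suc by (simp add: carrier_vec_Suc_bit)
qed

lemma vCons_add:
  assumes "dim_vec v = dim_vec w"
  shows "vCons a v + vCons b w = vCons (a + b) (v + w)"
  using assms by (auto simp: vec_eq_iff vec_index_vCons)

text \<open>When \<open>G\<close> is a group, \<open>\<theta>\<close> is a system of coordinates
  over the two-element field on a subgroup of order \<open>2 ^ k\<close>, that is, a choice of basis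
  for that subgroup.\<close>

definition bit_vec_embedding :: "('a, 'm) monoid_scheme \<Rightarrow> nat \<Rightarrow> (bit vec \<Rightarrow> 'a) \<Rightarrow> bool" where
  "bit_vec_embedding G k \<theta> \<longleftrightarrow>
     \<theta> ` carrier_vec k \<subseteq> carrier G \<and> inj_on \<theta> (carrier_vec k) \<and>
     (\<forall>v\<in>carrier_vec k. \<forall>w\<in>carrier_vec k. \<theta> (v + w) = \<theta> v \<otimes>\<^bsub>G\<^esub> \<theta> w)"

text \<open>This is basis extension: if \<open>c\<close> lies outside the image H of
  \<open>\<theta>\<close>, then H and its coset cH are disjoint and together form a subgroup twice
  as large. The new coordinate is the exponent of \<open>c\<close>.\<close>

lemma (in comm_group) bit_vec_embedding_extend:
  assumes sq: "\<And>x. x \<in> carrier G \<Longrightarrow> x \<otimes> x = \<one>"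
    and emb: "bit_vec_embedding G k \<theta>"
    and c: "c \<in> carrier G" "c \<notin> \<theta> ` carrier_vec k"
  shows "\<exists>\<theta>'. bit_vec_embedding G (Suc k) \<theta>'"
proof -
  let ?C = "carrier_vec k :: bit vec set"
  \<comment> \<open>\<open>p a\<close> is the power of \<open>c\<close> with exponent
    \<open>a\<close>; it respects addition of bits because \<open>c\<close> squares to the
    identity.\<close>
  define p :: "bit \<Rightarrow> 'a" where "p a = (if a = 0 then \<one> else c)" for a
  define \<theta>' where "\<theta>' v = p (v $ 0) \<otimes> \<theta> (vec k (\<lambda>i. v $ Suc i))" for v
  have cl: "\<theta> v \<in> carrier G" if "v \<in> ?C" for v
    using emb that by (auto simp: bit_vec_embedding_def)
  have add: "\<theta> (v + w) = \<theta> v \<otimes> \<theta> w" if "v \<in> ?C" "w \<in> ?C" for v w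
    using emb that by (auto simp: bit_vec_embedding_def)
  have inj: "v = w" if "v \<in> ?C" "w \<in> ?C" "\<theta> v = \<theta> w" for v w
    using emb that by (auto simp: bit_vec_embedding_def inj_on_def)
  have p: "p a \<in> carrier G" "p (a + b) = p a \<otimes> p b" for a b
    using c(1) sq by (cases a; cases b; simp add: p_def)+
  have \<theta>': "\<theta>' (vCons a v) = p a \<otimes> \<theta> v" if "v \<in> ?C" for a v
  proof -
    have "vec k (\<lambda>i. vCons a v $ Suc i) = v"
      using that by auto
    then show ?thesis by (simp add: \<theta>'_def)
  qed
  \<comment> \<open>Disjointness of the two cosets: multiplying a common element by
    \<open>\<theta> v\<close> would put \<open>c\<close> itself in the image of
    \<open>\<theta>\<close>.\<close>
  have nc: "c \<otimes> \<theta> v \<noteq> \<theta> w" if vw: "v \<in> ?C" "w \<in> ?C" for v w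
  proof
    assume "c \<otimes> \<theta> v = \<theta> w"
    then have "c \<otimes> (\<theta> v \<otimes> \<theta> v) = \<theta> w \<otimes> \<theta> v"
      using cl vw c(1) by (simp flip: m_assoc)
    then have "c = \<theta> (w + v)"
      using vw cl c(1) by (simp add: sq add)
    with c(2) vw show False by auto
  qed
  have split: "\<exists>a w. v = vCons a w \<and> w \<in> ?C" if "v \<in> carrier_vec (Suc k)" for v :: "bit vec"
    using that by (auto simp: carrier_vec_Suc_bit)
  have "inj_on \<theta>' (carrier_vec (Suc k))"
  proof (rule inj_onI)
    fix x y :: "bit vec"
    assume "x \<in> carrier_vec (Suc k)" "y \<in> carrier_vec (Suc k)" and eq: "\<theta>' x = \<theta>' y"
    then obtain a v b w where x: "x = vCons a v" "v \<in> ?C" and y: "y = vCons b w" "w \<in> ?C"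
      using split by blast
    have eq': "p a \<otimes> \<theta> v = p b \<otimes> \<theta> w"
      using eq x y by (simp add: \<theta>')
    have "a = b"
      using eq' nc[OF x(2) y(2)] nc[OF y(2) x(2)] cl x(2) y(2)
      by (cases a; cases b) (auto simp: p_def)
    moreover have "v = w"
      using eq' p(1) cl inj x(2) y(2) unfolding \<open>a = b\<close> by simp
    ultimately show "x = y"
      using x y by simp
  qed
  moreover have "\<theta>' ` carrier_vec (Suc k) \<subseteq> carrier G"
    using split \<theta>' p(1) cl by fastforce
  moreover have "\<theta>' (x + y) = \<theta>' x \<otimes> \<theta>' y"
    if xy: "x \<in> carrier_vec (Suc k)" "y \<in> carrier_vec (Suc k)" for x y
  proof -
    obtain a v b w where x: "x = vCons a v" "v \<in> ?C" and y: "y = vCons b w" "w \<in> ?C"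
      using split[OF xy(1)] split[OF xy(2)] by blast
    then have "x + y = vCons (a + b) (v + w)"
      by (simp add: vCons_add carrier_vecD[OF x(2)] carrier_vecD[OF y(2)] del: add_bit_eq_xor)
    then have "\<theta>' (x + y) = (p a \<otimes> p b) \<otimes> (\<theta> v \<otimes> \<theta> w)"
      using x(2) y(2) by (simp add: \<theta>' add p(2) del: add_bit_eq_xor)
    also have "\<dots> = (p a \<otimes> \<theta> v) \<otimes> (p b \<otimes> \<theta> w)"
      using p(1) cl x(2) y(2) by (simp add: m_ac)
    finally show ?thesis
      using x y by (simp add: \<theta>')
  qed
  ultimately show ?thesis
    unfolding bit_vec_embedding_def by blast
qed

text \<open>A coordinate system of greatest rank must be onto, since any element missed could be
  adjoined. Its inverse is the required \<open>\<phi>\<close>.\<close>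

lemma (in comm_group) exponent_two_iso_bit_vec:
  assumes fin: "finite (carrier G)"
    and sq: "\<And>x. x \<in> carrier G \<Longrightarrow> x \<otimes> x = \<one>"
  shows "\<exists>k (\<phi> :: 'a \<Rightarrow> bit vec). card (carrier G) = 2 ^ k \<and> bij_betw \<phi> (carrier G) (carrier_vec k) \<and>
           (\<forall>x\<in>carrier G. \<forall>y\<in>carrier G. \<phi> (x \<otimes> y) = \<phi> x + \<phi> y)"
proof -
  let ?P = "\<lambda>k. \<exists>\<theta>. bit_vec_embedding G k \<theta>"
  have "bit_vec_embedding G 0 (\<lambda>_. \<one>)"
    by (auto simp: bit_vec_embedding_def inj_on_def)
  then have "?P 0" by blast
  moreover have "k \<le> card (carrier G)" if "?P k" for k
  proof -
    from that obtain \<theta> where "bit_vec_embedding G k \<theta>" by blast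
    then have "card (carrier_vec k :: bit vec set) \<le> card (carrier G)"
      using fin by (auto simp: bit_vec_embedding_def intro: card_inj_on_le)
    then have "2 ^ k \<le> card (carrier G)"
      by (simp add: card_carrier_vec_bit)
    \<comment> \<open>Since \<open>k < 2 ^ k\<close>, the order of the group bounds the rank, so a
      greatest rank exists.\<close>
    then show ?thesis
      using less_exp[of k] by linarith
  qed
  ultimately obtain k where k: "?P k" and max: "\<And>m. ?P m \<Longrightarrow> m \<le> k"
    using Nat.ex_has_greatest_nat[of ?P 0 "card (carrier G)"] by blast
  from k obtain \<theta> where emb: "bit_vec_embedding G k \<theta>" by blast
  have "\<not> ?P (Suc k)"
    using max[of "Suc k"] by auto
  then have "carrier G \<subseteq> \<theta> ` carrier_vec k"
    using bit_vec_embedding_extend[OF sq emb] by blast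
  then have bij: "bij_betw \<theta> (carrier_vec k) (carrier G)"
    using emb by (auto simp: bit_vec_embedding_def bij_betw_def)
  define \<phi> where "\<phi> = inv_into (carrier_vec k) \<theta>"
  have bij': "bij_betw \<phi> (carrier G) (carrier_vec k)"
    unfolding \<phi>_def by (rule bij_betw_inv_into[OF bij])
  have "\<phi> (x \<otimes> y) = \<phi> x + \<phi> y" if "x \<in> carrier G" "y \<in> carrier G" for x y
  proof -
    have \<phi>: "\<phi> z \<in> carrier_vec k" "\<theta> (\<phi> z) = z" if "z \<in> carrier G" for z
      using bij' bij that by (auto simp: \<phi>_def bij_betw_inv_into_right dest: bij_betwE)
    have "\<theta> (\<phi> x + \<phi> y) = x \<otimes> y"
      using emb \<phi> that by (simp add: bit_vec_embedding_def)
    moreover have "\<phi> x + \<phi> y \<in> carrier_vec k"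
      using \<phi> that by simp
    ultimately show ?thesis
      using bij unfolding \<phi>_def by (metis bij_betw_inv_into_left)
  qed
  moreover have "card (carrier G) = 2 ^ k"
    using bij_betw_same_card[OF bij] by (simp add: card_carrier_vec_bit)
  ultimately show ?thesis
    using bij' by blast
qed

section \<open>The group of a parity edge-coloring by perfect matchings\<close>

locale matching_parity_coloring =
  fixes V :: "'v set" and f :: "'v set \<Rightarrow> 'c"
  assumes parity: "parity_edge_coloring V (complete_graph_edges V) f"
    and matching: "\<forall>c \<in> f ` complete_graph_edges V.
           perfect_matching V (complete_graph_edges V)
             (color_class (complete_graph_edges V) f c)"
begin

definition colors :: "'c set" where
  "colors = f ` complete_graph_edges V"

text \<open>This is the involution \<open>\<sigma>\<^sub>c\<close>. Its value is meaningful only for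
  a used color and a vertex of \<open>V\<close>, where \<open>ex1_partner\<close> applies.\<close>

definition partner :: "'c \<Rightarrow> 'v \<Rightarrow> 'v" where
  "partner c v = (THE w. w \<in> V \<and> w \<noteq> v \<and> f {v, w} = c)"

lemma color_in_colors: "u \<in> V \<Longrightarrow> v \<in> V \<Longrightarrow> u \<noteq> v \<Longrightarrow> f {u, v} \<in> colors"
  by (auto simp: colors_def complete_graph_edges_def)

lemma ex1_partner:
  assumes "c \<in> colors" "v \<in> V"
  shows "\<exists>!w. w \<in> V \<and> w \<noteq> v \<and> f {v, w} = c"
proof -
  let ?M = "color_class (complete_graph_edges V) f c"
  have edge: "{v, w} \<in> ?M \<longleftrightarrow> w \<in> V \<and> w \<noteq> v \<and> f {v, w} = c" for w
    using assms(2) by (auto simp: color_class_def complete_graph_edges_def)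
  have "\<exists>!e. e \<in> ?M \<and> v \<in> e"
    using matching assms unfolding colors_def perfect_matching_def by blast
  then obtain e where e: "e \<in> ?M" "v \<in> e" and uniq: "\<And>e'. e' \<in> ?M \<Longrightarrow> v \<in> e' \<Longrightarrow> e' = e"
    by blast
  have "\<exists>w. e = {v, w}"
    using e by (auto simp: color_class_def complete_graph_edges_def nsets_2_eq)
  then obtain w where w: "e = {v, w}" ..
  have "w' = w" if "w' \<in> V \<and> w' \<noteq> v \<and> f {v, w'} = c" for w'
  proof -
    have "{v, w'} = {v, w}"
      using uniq[of "{v, w'}"] edge[of w'] that w by simp
    then show ?thesis by (auto simp: doubleton_eq_iff)
  qed
  moreover have "w \<in> V \<and> w \<noteq> v \<and> f {v, w} = c"
    using e w edge by simp
  ultimately show ?thesis by blast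
qed

lemma
  assumes "c \<in> colors" "v \<in> V"
  shows partner_in: "partner c v \<in> V"
    and partner_neq: "partner c v \<noteq> v"
    and color_partner: "f {v, partner c v} = c"
  using theI'[OF ex1_partner[OF assms]] by (auto simp: partner_def)

lemma partner_eqI: "u \<in> V \<Longrightarrow> v \<in> V \<Longrightarrow> u \<noteq> v \<Longrightarrow> partner (f {u, v}) u = v"
  using ex1_partner[of "f {u, v}" u] color_in_colors[of u v] partner_in partner_neq color_partner
  by metis

lemma partner_partner: "c \<in> colors \<Longrightarrow> v \<in> V \<Longrightarrow> partner c (partner c v) = v"
  by (metis color_partner insert_commute partner_eqI partner_in partner_neq)

text \<open>The four-edge walk is centered at \<open>x\<close> and runs two steps out each way, so
  its endpoints are the two sides of the claim. Its colors are \<open>a\<close>, \<open>c\<close>,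
  \<open>a\<close>, \<open>c\<close>; every coincidence of vertices other than that of the endpoints
  is excluded, so parity forces the endpoints to agree.\<close>

lemma partner_commute:
  assumes a: "a \<in> colors" and c: "c \<in> colors" and x: "x \<in> V"
  shows "partner a (partner c x) = partner c (partner a x)"
proof (cases "a = c")
  case False
  define q p r s where "q = partner c x" and "p = partner a q"
    and "r = partner a x" and "s = partner c r"
  note defs = p_def q_def r_def s_def
  have V: "p \<in> V" "q \<in> V" "r \<in> V" "s \<in> V"
    using assms by (auto simp: defs partner_in)
  have col: "f {p, q} = a" "f {q, x} = c" "f {x, r} = a" "f {r, s} = c"
    using color_partner[OF a V(2)] color_partner[OF c x] color_partner[OF a x]
      color_partner[OF c V(3)] by (simp_all add: defs insert_commute)
  have adj: "p \<noteq> q" "q \<noteq> x" "x \<noteq> r" "r \<noteq> s"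
    using partner_neq[OF a V(2)] partner_neq[OF c x] partner_neq[OF a x]
      partner_neq[OF c V(3)] by (simp_all add: defs)
  \<comment> \<open>If vertices two steps apart coincided, two consecutive edges would be equal and
    \<open>a = c\<close>.\<close>
  have "q \<noteq> r" "p \<noteq> x" "s \<noteq> x"
    using col False by (auto simp: insert_commute)
  \<comment> \<open>Vertices three steps apart: applying the injective \<open>partner a\<close> or
    \<open>partner c\<close> backwards would identify two adjacent vertices.\<close>
  moreover have "p \<noteq> r"
    using partner_partner[OF a V(2)] partner_partner[OF a x] adj by (auto simp: p_def r_def)
  moreover have "q \<noteq> s"
    using partner_partner[OF c V(3)] partner_partner[OF c x] adj by (auto simp: q_def s_def)
  moreover have "\<not> parity_path V (complete_graph_edges V) f [p, q, x, r, s]"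
    using parity by (auto simp: parity_edge_coloring_def)
  moreover have "parity_walk V (complete_graph_edges V) f [p, q, x, r, s]"
    using V x adj
    by (simp add: parity_walk_def walk_def complete_graph_edges_def col)
  ultimately have "p = s"
    using adj by (auto simp: parity_path_def)
  then show ?thesis by (simp add: defs)
qed simp

text \<open>The group element that carries the base point \<open>b\<close> to \<open>u\<close>. The
  case \<open>u = b\<close> is the identity and is separate because \<open>{b, b}\<close> is not an
  edge, so its color means nothing.\<close>

definition translate :: "'v \<Rightarrow> 'v \<Rightarrow> 'v \<Rightarrow> 'v" where
  "translate b u v = (if u = b then v else partner (f {b, u}) v)"

definition vertex_group :: "'v \<Rightarrow> 'v monoid" where
  "vertex_group b = \<lparr>carrier = V, mult = translate b, one = b\<rparr>"

context
  fixes b :: 'v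
  assumes b: "b \<in> V"
begin

lemma translate_in: "u \<in> V \<Longrightarrow> v \<in> V \<Longrightarrow> translate b u v \<in> V"
  using b by (auto simp: translate_def partner_in color_in_colors)

lemma translate_base: "u \<in> V \<Longrightarrow> translate b u b = u"
  using b by (auto simp: translate_def partner_eqI)

lemma translate_involution: "u \<in> V \<Longrightarrow> v \<in> V \<Longrightarrow> translate b u (translate b u v) = v"
  using b by (auto simp: translate_def partner_partner color_in_colors)

lemma translate_left_commute:
  "u \<in> V \<Longrightarrow> v \<in> V \<Longrightarrow> w \<in> V \<Longrightarrow>
     translate b u (translate b v w) = translate b v (translate b u w)"
  using b by (auto simp: translate_def partner_commute color_in_colors)

text \<open>Commuting translations are evaluated at \<open>b\<close>, where each one returns its own
  index.\<close>

lemma translate_commute: "u \<in> V \<Longrightarrow> v \<in> V \<Longrightarrow> translate b u v = translate b v u"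
  using translate_left_commute[of u v b] b by (simp add: translate_base)

lemma translate_self: "u \<in> V \<Longrightarrow> translate b u u = b"
  using translate_involution[of u b] b by (simp add: translate_base)

lemma comm_group_vertex_group: "comm_group (vertex_group b)"
proof (rule comm_groupI)
  fix x y z
  assume xyz: "x \<in> carrier (vertex_group b)" "y \<in> carrier (vertex_group b)"
    "z \<in> carrier (vertex_group b)"
  \<comment> \<open>Associativity follows from commutation alone: (xy)z = z(xy) = x(zy) =
    x(yz).\<close>
  have "translate b (translate b x y) z = translate b z (translate b x y)"
    using xyz by (intro translate_commute) (auto simp: vertex_group_def translate_in)
  also have "\<dots> = translate b x (translate b z y)"
    using xyz by (intro translate_left_commute) (auto simp: vertex_group_def)
  also have "translate b z y = translate b y z"
    using xyz by (intro translate_commute) (auto simp: vertex_group_def)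
  finally show "x \<otimes>\<^bsub>vertex_group b\<^esub> y \<otimes>\<^bsub>vertex_group b\<^esub> z
      = x \<otimes>\<^bsub>vertex_group b\<^esub> (y \<otimes>\<^bsub>vertex_group b\<^esub> z)"
    by (simp add: vertex_group_def)
next
  fix x
  assume "x \<in> carrier (vertex_group b)"
  then show "\<exists>y\<in>carrier (vertex_group b). y \<otimes>\<^bsub>vertex_group b\<^esub> x = \<one>\<^bsub>vertex_group b\<^esub>"
    by (auto simp: vertex_group_def intro: translate_self)
qed (use b in \<open>auto simp: vertex_group_def translate_in intro: translate_commute,
  simp add: translate_def\<close>)

text \<open>With w the product of \<open>u\<close> and \<open>v\<close>, exponent two makes
  translation by w carry \<open>u\<close> to \<open>v\<close>. Hence w is not the identity
  \<open>b\<close>, and the matching of color \<open>f {b, w}\<close> pairs \<open>u\<close> with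
  \<open>v\<close>.\<close>

lemma color_eq_color_translate:
  assumes u: "u \<in> V" and v: "v \<in> V" and uv: "u \<noteq> v"
  shows "translate b u v \<noteq> b" "f {u, v} = f {b, translate b u v}"
proof -
  let ?w = "translate b u v"
  have w: "?w \<in> V" by (rule translate_in[OF u v])
  have wu: "translate b ?w u = v"
    using translate_commute[OF w u] translate_involution[OF u v] by simp
  show wb: "?w \<noteq> b"
    using wu uv by (auto simp: translate_def split: if_splits)
  then have "partner (f {b, ?w}) u = v"
    using wu by (simp add: translate_def[of b ?w])
  then show "f {u, v} = f {b, ?w}"
    using color_partner[of "f {b, ?w}" u] color_in_colors[OF b w] wb u by auto
qed

end

lemma canonical:
  assumes "finite V" "V \<noteq> {}"
  shows "\<exists>k. card V = 2 ^ k \<and> canonical_coloring k V f"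
proof -
  obtain b where b: "b \<in> V" using assms(2) by blast
  interpret G: comm_group "vertex_group b" by (rule comm_group_vertex_group[OF b])
  obtain k and \<phi> :: "'v \<Rightarrow> bit vec" where card: "card V = 2 ^ k"
    and bij: "bij_betw \<phi> V (carrier_vec k)"
    and hom: "\<And>u v. u \<in> V \<Longrightarrow> v \<in> V \<Longrightarrow> \<phi> (translate b u v) = \<phi> u + \<phi> v"
    using G.exponent_two_iso_bit_vec assms(1) translate_self[OF b]
    by (auto simp: vertex_group_def)
  \<comment> \<open>The name is forced: \<open>\<phi>\<close> sends the identity \<open>b\<close> to
    0, so the edge from \<open>b\<close> to its partner must be named by the coordinates of that
    partner.\<close>
  define \<psi> where "\<psi> c = \<phi> (partner c b)" for c
  have "inj_on \<psi> colors"
  proof (rule inj_onI)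
    fix c d
    assume cd: "c \<in> colors" "d \<in> colors" "\<psi> c = \<psi> d"
    then have "partner c b = partner d b"
      using bij b by (auto simp: \<psi>_def bij_betw_def inj_on_def partner_in)
    then show "c = d"
      using color_partner[OF cd(1) b] color_partner[OF cd(2) b] by metis
  qed
  moreover have "\<psi> ` colors \<subseteq> carrier_vec k"
    using bij b partner_in by (auto simp: \<psi>_def dest: bij_betwE)
  \<comment> \<open>The edge is replaced by the edge of the same color from \<open>b\<close> to the
    product of \<open>u\<close> and \<open>v\<close>; that product is then the partner of
    \<open>b\<close>.\<close>
  moreover have "\<psi> (f {u, v}) = \<phi> u + \<phi> v" if "u \<in> V" "v \<in> V" "u \<noteq> v" for u v
    using color_eq_color_translate[OF b that] translate_in[OF b that(1,2)] that b
    by (simp add: \<psi>_def partner_eqI hom)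
  ultimately have "canonical_coloring k V f"
    unfolding canonical_coloring_def colors_def using bij by blast
  with card show ?thesis by blast
qed

end

theorem theorem3p5:
  fixes V :: "'v set" and f :: "'v set \<Rightarrow> 'c" and n :: nat
  assumes "finite V" and "card V = n" and "n \<ge> 1"
    and "parity_edge_coloring V (complete_graph_edges V) f"
    and "\<forall>c \<in> f ` complete_graph_edges V.
           perfect_matching V (complete_graph_edges V)
             (color_class (complete_graph_edges V) f c)"
  shows "\<exists>k. n = 2 ^ k \<and> canonical_coloring k V f"
proof -
  interpret matching_parity_coloring V f
    using assms by unfold_locales
  \<comment> \<open>A base point exists because \<open>n \<ge> 1\<close>; a single vertex gives
    \<open>k = 0\<close> and no colors.\<close>
  have "V \<noteq> {}"
    using assms(2,3) by auto
  then show ?thesis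
    using canonical assms(1,2) by simp
qed

end
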